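(* Let $N\ge1$, $0<p<1$, $-\mu^*<\mu<\frac14$, $\mu\ne0$, and let $u=u(\delta)$ be a positive radial solution of $\Delta u+\frac{\mu}{\delta^2}u=u^p$ near the outer boundary $r=R$ of a ball or annulus, or near the inner boundary $r=r_0>0$ of an annulus, such that $\frac{u(\delta)}{\delta^{\beta_-}}\to0$ as $\delta\to0$. Then $w(\delta):=\frac{u(\delta)}{\delta^{\beta_+}}$ has a limit $w(0)$ as $\delta\to0$, and if $w(0)\ne0$ we get $$w(\delta)=w(0)+O(\delta^\alpha),\qquad\text{where }\alpha=\min\{1,\,2-\beta_+(1-p)\}>0.$$ Moreover, if $-\frac{p}{(1-p)^2}<\mu$, we have $\alpha=1$ and $$w'(0)=\frac{N-1}{2R}w(0)\ \text{ at the outer boundary } r=R,\qquad w'(0)=-\frac{N-1}{2r_0}w(0)\ \text{ at the inner boundary } r=r_0.$$ If $w(0)=0$ we have $w(\delta)=o(\delta^\alpha)$.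
   Context: $\mu^*=\frac{2(p+1)}{(1-p)^2}$, $\beta_\pm=\frac12\pm\sqrt{\frac14-\mu}$. The ball is $B_R=\{|x|<R\}\subset\mathbb{R}^N$, the annulus is $\{r_0<|x|<R\}$, and $\delta$ is the distance to the boundary: $\delta=R-r$ near the outer boundary, $\delta=r-r_0$ near the inner boundary, $r=|x|$. Radial solutions satisfy $u''+\frac{N-1}{r}u'+\frac{\mu}{\delta^2}u=u^p$ (derivatives in $r$); a solution near the boundary is one defined for $0<\delta<\delta_0$ for some $\delta_0>0$ and is regarded as a function of $\delta$. $w'$ is the derivative with respect to $\delta$. *)

theory Defs
  imports "HOL-Analysis.Analysis" "HOL-Library.Landau_Symbols"
begin

definition mu_star :: "real \<Rightarrow> real" where
  "mu_star p = 2 * (p + 1) / (1 - p)^2"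

definition beta_plus :: "real \<Rightarrow> real" where
  "beta_plus \<mu> = 1/2 + sqrt (1/4 - \<mu>)"

definition beta_minus :: "real \<Rightarrow> real" where
  "beta_minus \<mu> = 1/2 - sqrt (1/4 - \<mu>)"

definition alpha :: "real \<Rightarrow> real \<Rightarrow> real" where
  "alpha p \<mu> = min 1 (2 - beta_plus \<mu> * (1 - p))"

text \<open>
  The radial form of \<open>\<Delta>v + \<mu>/\<delta>\<^sup>2 v = v\<^sup>p\<close> in dimension \<open>N\<close>, as an equation in the
  radius \<open>r\<close>; it is only used on open intervals \<open>S\<close> of positive radii.
\<close>

definition radial_solution_on ::
  "nat \<Rightarrow> real \<Rightarrow> real \<Rightarrow> (real \<Rightarrow> real) \<Rightarrow> real set \<Rightarrow> (real \<Rightarrow> real) \<Rightarrow> bool" where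
  "radial_solution_on N p \<mu> \<delta> S v \<longleftrightarrow>
     (\<exists>v' v''. \<forall>r\<in>S.
        (v has_real_derivative v' r) (at r) \<and>
        (v' has_real_derivative v'' r) (at r) \<and>
        v'' r + (real N - 1) / r * v' r + \<mu> / (\<delta> r)^2 * v r = v r powr p)"

text \<open>
  In the next two definitions the solution \<open>u\<close> is given as a function of the distance to the
  boundary. The collar width \<open>\<delta>0\<close> may be arbitrarily small, so these notions cover every ball
  and annulus with the given boundary sphere; \<open>\<delta>0 \<le> R\<close> only keeps the radii positive.
\<close>

definition positive_solution_near_outer ::
  "nat \<Rightarrow> real \<Rightarrow> real \<Rightarrow> real \<Rightarrow> (real \<Rightarrow> real) \<Rightarrow> bool" where
  "positive_solution_near_outer N p \<mu> R u \<longleftrightarrow>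
     (\<exists>\<delta>0. 0 < \<delta>0 \<and> \<delta>0 \<le> R \<and> (\<forall>\<delta>\<in>{0<..<\<delta>0}. 0 < u \<delta>) \<and>
        radial_solution_on N p \<mu> (\<lambda>r. R - r) {R - \<delta>0<..<R} (\<lambda>r. u (R - r)))"

definition positive_solution_near_inner ::
  "nat \<Rightarrow> real \<Rightarrow> real \<Rightarrow> real \<Rightarrow> (real \<Rightarrow> real) \<Rightarrow> bool" where
  "positive_solution_near_inner N p \<mu> r0 u \<longleftrightarrow>
     0 < r0 \<and>
     (\<exists>\<delta>0. 0 < \<delta>0 \<and> (\<forall>\<delta>\<in>{0<..<\<delta>0}. 0 < u \<delta>) \<and>
        radial_solution_on N p \<mu> (\<lambda>r. r - r0) {r0<..<r0 + \<delta>0} (\<lambda>r. u (r - r0)))"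

definition w_of :: "real \<Rightarrow> (real \<Rightarrow> real) \<Rightarrow> real \<Rightarrow> real" where
  "w_of \<mu> u \<delta> = u \<delta> / \<delta> powr beta_plus \<mu>"

text \<open>
  The one-sided derivative at \<open>0\<close> of the extension of \<open>w\<close> by its boundary value \<open>w0\<close>
  (the actual HOL value \<open>w 0\<close> is irrelevant).
\<close>

definition has_boundary_derivative :: "(real \<Rightarrow> real) \<Rightarrow> real \<Rightarrow> real \<Rightarrow> bool" where
  "has_boundary_derivative w w0 D \<longleftrightarrow>
     ((w(0 := w0)) has_real_derivative D) (at 0 within {0..})"

end

theory Submission imports Defs begin

text \<open>
  Let \<open>r = b + \<sigma> \<delta>\<close> be the radius, where \<open>b\<close> is the boundary radius and \<open>\<sigma> = \<plusminus>1\<close>, and let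
  \<open>m = (N - 1) / 2\<close>, \<open>\<beta> = \<beta>\<^sub>+\<close> and \<open>\<kappa> = 2 - \<beta> (1 - p)\<close>. Multiplying \<open>u\<close> by \<open>r\<^sup>m\<close> removes the first-order
  term: \<open>W = r\<^sup>m u / \<delta>\<^sup>\<beta>\<close> satisfies
  \<open>(\<delta>\<^bsup>2\<beta>\<^esup> W')' = \<delta>\<^bsup>2\<beta>\<^esup> (r\<^bsup>m (1 - p)\<^esup> \<delta>\<^bsup>\<kappa> - 2\<^esup> W\<^sup>p + m (m - 1) r\<^bsup>-2\<^esup> W)\<close>.
  The hypothesis \<open>u = o(\<delta>\<^bsup>1 - \<beta>\<^esup>)\<close> forces the flux \<open>\<delta>\<^bsup>2\<beta>\<^esup> W'\<close> to vanish at the boundary, so it is bounded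
  by the integral of the right-hand side. Once \<open>W\<close> is known to be bounded, a second integration
  gives \<open>W = W(0) + O(\<delta>\<^sup>\<kappa>)\<close>, with an arbitrarily small constant if \<open>W(0) = 0\<close>. Boundedness follows by
  absorbing the right-hand side into \<open>sup (1 + W) / (1 + \<eta> \<delta>\<^bsup>1 - 2\<beta>\<^esup>)\<close>, which is finite for every
  \<open>\<eta> > 0\<close>, on a short interval independent of \<open>\<eta>\<close>, and letting \<open>\<eta> \<rightarrow> 0\<close>. Since \<open>W\<close> has derivative \<open>0\<close>
  at the boundary when \<open>\<kappa> > 1\<close>, the boundary derivative of \<open>w = r\<^bsup>-m\<^esup> W\<close> is that of the factor
  \<open>r\<^bsup>-m\<^esup>\<close>.
\<close>

section \<open>Comparison of derivatives and powers near zero\<close>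

text \<open>Stands in for integration over \<open>{a..b}\<close>: the integral estimates below come
  from comparison with an explicit antiderivative.\<close>

lemma diff_le_diff_of_deriv_le:
  fixes f g :: "real \<Rightarrow> real"
  assumes "a \<le> b"
    and "\<And>x. a \<le> x \<Longrightarrow> x \<le> b \<Longrightarrow> (f has_real_derivative f' x) (at x)"
    and "\<And>x. a \<le> x \<Longrightarrow> x \<le> b \<Longrightarrow> (g has_real_derivative g' x) (at x)"
    and "\<And>x. a \<le> x \<Longrightarrow> x \<le> b \<Longrightarrow> f' x \<le> g' x"
  shows "f b - f a \<le> g b - g a"
proof -
  have "g a - f a \<le> g b - f b"
  proof (rule DERIV_nonneg_imp_nondecreasing[of a b "\<lambda>x. g x - f x"])
    fix x assume "a \<le> x" "x \<le> b"
    then have "((\<lambda>x. g x - f x) has_real_derivative g' x - f' x) (at x)" "0 \<le> g' x - f' x"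
      using assms by (auto intro!: DERIV_diff)
    then show "\<exists>y. ((\<lambda>x. g x - f x) has_real_derivative y) (at x) \<and> 0 \<le> y" by blast
  qed fact
  then show ?thesis by simp
qed

lemma has_real_derivative_powr_divide:
  fixes a x :: real
  assumes "0 < x" "a \<noteq> 0"
  shows "((\<lambda>x. x powr a / a) has_real_derivative x powr (a - 1)) (at x)"
  using assms by (auto intro!: derivative_eq_intros)

lemma powr_tendsto_0_at_right:
  fixes a :: real
  assumes "0 < a"
  shows "((\<lambda>s. s powr a) \<longlongrightarrow> 0) (at_right 0)"
proof -
  have "((\<lambda>s::real. s) \<longlongrightarrow> 0) (at_right 0)" by (rule tendsto_ident_at)
  from tendsto_powr'[OF this tendsto_const, of a] assms show ?thesis
    by (auto simp: less_imp_le eventually_at_right_field)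
qed

section \<open>The flux at the boundary\<close>

text \<open>If the flux exceeded \<open>G\<close> at \<open>t\<close> by \<open>c > 0\<close>, the
  excess would persist towards \<open>0\<close>, because \<open>D' \<le> G'\<close>. Then
  \<open>w' s\<close> would be at least \<open>c * s powr (-2*\<beta>)\<close>, which drives
  \<open>w\<close> to minus infinity at the rate \<open>s powr (1 - 2*\<beta>)\<close>;
  \<open>lim\<close> excludes this.\<close>

lemma flux_le:
  fixes \<beta> t :: real and w w' D' G G' :: "real \<Rightarrow> real"
  assumes beta: "1/2 < \<beta>"
    and w: "\<And>s. 0 < s \<Longrightarrow> s \<le> t \<Longrightarrow> (w has_real_derivative w' s) (at s)"
    and D: "\<And>s. 0 < s \<Longrightarrow> s \<le> t \<Longrightarrow> ((\<lambda>s. s powr (2*\<beta>) * w' s) has_real_derivative D' s) (at s)"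
    and G: "\<And>s. 0 < s \<Longrightarrow> s \<le> t \<Longrightarrow> (G has_real_derivative G' s) (at s)"
    and le: "\<And>s. 0 < s \<Longrightarrow> s \<le> t \<Longrightarrow> D' s \<le> G' s"
    and pos: "\<And>s. 0 < s \<Longrightarrow> s \<le> t \<Longrightarrow> 0 \<le> G s"
    and lim: "((\<lambda>s. s powr (2*\<beta> - 1) * w s) \<longlongrightarrow> 0) (at_right 0)"
    and t: "0 < t"
  shows "t powr (2*\<beta>) * w' t \<le> G t"
proof (rule ccontr)
  assume neg: "\<not> ?thesis"
  define c where "c = t powr (2*\<beta>) * w' t - G t"
  have c: "0 < c" using neg by (simp add: c_def)
  define k where "k = 2*\<beta> - 1"
  have k: "0 < k" using beta by (simp add: k_def)
  have w'_ge: "c * a powr (- k - 1) \<le> w' a" if a: "0 < a" "a \<le> t" for a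
  proof -
    have "t powr (2*\<beta>) * w' t - a powr (2*\<beta>) * w' a \<le> G t - G a"
      by (rule diff_le_diff_of_deriv_le[where f = "\<lambda>s. s powr (2*\<beta>) * w' s" and f' = D' and g' = G'])
        (use a t in \<open>auto intro!: D G le\<close>)
    then have "c \<le> a powr (2*\<beta>) * w' a" using pos[of a] a t by (simp add: c_def)
    then have "c * a powr (- (2*\<beta>)) \<le> a powr (2*\<beta>) * w' a * a powr (- (2*\<beta>))"
      by (rule mult_right_mono) simp
    also have "\<dots> = w' a" using a by (simp add: powr_minus)
    finally show ?thesis by (simp add: k_def)
  qed
  \<comment> \<open>Integrate the lower bound for \<open>w'\<close> from \<open>a\<close> to
    \<open>t\<close> and multiply by \<open>a powr k\<close>. As \<open>a\<close> tends to
    \<open>0\<close>, the left side tends to \<open>c / k\<close> and the right side to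
    \<open>0\<close>.\<close>
  have ineq: "c * (1 - a powr k * t powr (-k)) / k \<le> a powr k * w t - a powr k * w a"
    if a: "0 < a" "a < t" for a
  proof -
    have "c * (t powr (-k) / (-k)) - c * (a powr (-k) / (-k)) \<le> w t - w a"
    proof (rule diff_le_diff_of_deriv_le[where f = "\<lambda>s. c * (s powr (-k) / (-k))"
          and f' = "\<lambda>s. c * s powr (-k-1)" and g' = w'])
      fix s assume "a \<le> s" "s \<le> t"
      then show "((\<lambda>s. c * (s powr (-k) / (-k))) has_real_derivative c * s powr (-k-1)) (at s)"
        using a k by (intro DERIV_cmult has_real_derivative_powr_divide) auto
    qed (use a t in \<open>auto intro!: w w'_ge\<close>)
    then have "a powr k * (c * (a powr (-k) - t powr (-k)) / k) \<le> a powr k * (w t - w a)"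
      using k by (intro mult_left_mono) (auto simp: field_simps)
    moreover have "a powr k * a powr (-k) = 1" using a by (simp add: powr_minus)
    ultimately show ?thesis using k by (simp add: field_simps)
  qed
  have ev: "\<forall>\<^sub>F a in at_right 0. c * (1 - a powr k * t powr (-k)) / k \<le> a powr k * w t - a powr k * w a"
    using ineq t
    by (auto simp: eventually_at_right_field)
  have pk: "((\<lambda>s::real. s powr k) \<longlongrightarrow> 0) (at_right 0)" by (rule powr_tendsto_0_at_right[OF k])
  have "((\<lambda>a. c * (1 - a powr k * t powr (-k)) / k) \<longlongrightarrow> c * (1 - 0 * t powr (-k)) / k) (at_right 0)"
    using k by (intro tendsto_intros pk) auto
  moreover have "((\<lambda>a. a powr k * w t - a powr k * w a) \<longlongrightarrow> 0 * w t - 0) (at_right 0)"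
    using lim by (intro tendsto_intros pk) (auto simp: k_def)
  ultimately have "c * (1 - 0 * t powr (-k)) / k \<le> 0 * w t - 0"
    by (intro tendsto_le[OF _ _ _ ev]) auto
  then show False using c k by (simp add: field_simps)
qed

lemma abs_flux_le:
  fixes \<beta> t :: real and w w' D' G G' :: "real \<Rightarrow> real"
  assumes beta: "1/2 < \<beta>"
    and w: "\<And>s. 0 < s \<Longrightarrow> s \<le> t \<Longrightarrow> (w has_real_derivative w' s) (at s)"
    and D: "\<And>s. 0 < s \<Longrightarrow> s \<le> t \<Longrightarrow> ((\<lambda>s. s powr (2*\<beta>) * w' s) has_real_derivative D' s) (at s)"
    and G: "\<And>s. 0 < s \<Longrightarrow> s \<le> t \<Longrightarrow> (G has_real_derivative G' s) (at s)"
    and le: "\<And>s. 0 < s \<Longrightarrow> s \<le> t \<Longrightarrow> \<bar>D' s\<bar> \<le> G' s"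
    and pos: "\<And>s. 0 < s \<Longrightarrow> s \<le> t \<Longrightarrow> 0 \<le> G s"
    and lim: "((\<lambda>s. s powr (2*\<beta> - 1) * w s) \<longlongrightarrow> 0) (at_right 0)"
    and t: "0 < t"
  shows "t powr (2*\<beta>) * \<bar>w' t\<bar> \<le> G t"
proof -
  have "t powr (2*\<beta>) * w' t \<le> G t"
    by (rule flux_le[OF beta w D G _ pos lim t]) (auto dest: le)
  moreover have "t powr (2*\<beta>) * (- w' t) \<le> G t"
  proof (rule flux_le[OF beta _ _ G _ pos _ t, where w = "\<lambda>s. - w s" and D' = "\<lambda>s. - D' s"])
    show "((\<lambda>s. s powr (2*\<beta> - 1) * - w s) \<longlongrightarrow> 0) (at_right 0)"
      using tendsto_minus[OF lim] by simp
    show "((\<lambda>s. s powr (2*\<beta>) * - w' s) has_real_derivative - D' s) (at s)" if "0 < s" "s \<le> t" for s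
      using DERIV_minus[OF D[OF that]] by simp
    show "- D' s \<le> G' s" if "0 < s" "s \<le> t" for s using le[OF that] by simp
  qed (auto intro: DERIV_minus w)
  ultimately show ?thesis by (cases "0 \<le> w' t") auto
qed

section \<open>Limits and bounds from the integrated equation\<close>

text \<open>The flux bound makes \<open>\<bar>w' s\<bar>\<close> at most a multiple of
  \<open>s powr (\<kappa> - 1)\<close>, which is integrable at \<open>0\<close> since \<kappa> is
  positive. The constant stays explicit and proportional to \<open>K\<close>, because the case of a
  zero limit uses arbitrarily small \<open>K\<close>.\<close>

lemma boundary_limit:
  fixes \<beta> \<kappa> d K :: real and w w' D' :: "real \<Rightarrow> real"
  assumes beta: "1/2 < \<beta>" and kappa: "0 < \<kappa>" and d: "0 < d" and K: "0 \<le> K"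
    and w: "\<And>s. 0 < s \<Longrightarrow> s < d \<Longrightarrow> (w has_real_derivative w' s) (at s)"
    and D: "\<And>s. 0 < s \<Longrightarrow> s < d \<Longrightarrow> ((\<lambda>s. s powr (2*\<beta>) * w' s) has_real_derivative D' s) (at s)"
    and le: "\<And>s. 0 < s \<Longrightarrow> s < d \<Longrightarrow> \<bar>D' s\<bar> \<le> K * s powr (2*\<beta> + \<kappa> - 2)"
    and lim: "((\<lambda>s. s powr (2*\<beta> - 1) * w s) \<longlongrightarrow> 0) (at_right 0)"
  obtains w0 where "(w \<longlongrightarrow> w0) (at_right 0)"
    and "\<And>s. 0 < s \<Longrightarrow> s < d \<Longrightarrow> \<bar>w s - w0\<bar> \<le> K / (\<kappa> * (2*\<beta> + \<kappa> - 1)) * s powr \<kappa>"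
proof -
  \<comment> \<open>The first integration divides by \<open>e\<close>; the second, applied to
    \<open>s powr (\<kappa> - 1)\<close>, divides by \<kappa>. Together they give
    \<open>L\<close>.\<close>
  define e where "e = 2*\<beta> + \<kappa> - 1"
  define L where "L = K / (\<kappa> * e)"
  have e: "0 < e" using beta kappa by (simp add: e_def)
  have L: "0 \<le> L" using K e kappa by (simp add: L_def)
  have w': "\<bar>w' s\<bar> \<le> K / e * s powr (\<kappa> - 1)" if s: "0 < s" "s < d" for s
  proof -
    have "s powr (2*\<beta>) * \<bar>w' s\<bar> \<le> K * (s powr e / e)"
    proof (rule abs_flux_le[OF beta w D _ _ _ lim s(1), where G' = "\<lambda>s. K * s powr (e - 1)"])
      show "((\<lambda>s. K * (s powr e / e)) has_real_derivative K * s powr (e - 1)) (at s)" if "0 < s" for s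
        using that e by (intro DERIV_cmult has_real_derivative_powr_divide) auto
      show "\<bar>D' t\<bar> \<le> K * t powr (e - 1)" if "0 < t" "t \<le> s" for t
        using le[of t] that s by (simp add: e_def algebra_simps)
    qed (use K e s in auto)
    also have "\<dots> = s powr (2*\<beta>) * (K / e * s powr (\<kappa> - 1))"
      by (simp add: e_def algebra_simps flip: powr_add)
    finally have "s powr (2*\<beta>) * \<bar>w' s\<bar> \<le> s powr (2*\<beta>) * (K / e * s powr (\<kappa> - 1))" .
    then show ?thesis by (rule mult_left_le_imp_le) (use s in simp)
  qed
  have diff: "\<bar>w b - w a\<bar> \<le> L * (b powr \<kappa> - a powr \<kappa>)" if ab: "0 < a" "a \<le> b" "b < d" for a b
  proof -
    have der: "((\<lambda>s. K / e * (s powr \<kappa> / \<kappa>)) has_real_derivative K / e * s powr (\<kappa> - 1)) (at s)"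
      if "a \<le> s" for s
      using that ab kappa by (intro DERIV_cmult has_real_derivative_powr_divide) auto
    have "w b - w a \<le> K / e * (b powr \<kappa> / \<kappa>) - K / e * (a powr \<kappa> / \<kappa>)"
      by (rule diff_le_diff_of_deriv_le[OF ab(2) _ der, where f' = w'])
        (use ab w' in \<open>auto intro!: w simp: abs_le_iff\<close>)
    moreover have "- w b - - w a \<le> K / e * (b powr \<kappa> / \<kappa>) - K / e * (a powr \<kappa> / \<kappa>)"
      by (rule diff_le_diff_of_deriv_le[OF ab(2) _ der, where f = "\<lambda>s. - w s" and f' = "\<lambda>s. - w' s"])
        (use ab w' in \<open>auto intro!: DERIV_minus w simp: abs_le_iff\<close>)
    ultimately show ?thesis by (simp add: L_def abs_le_iff diff_divide_distrib algebra_simps)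
  qed
  \<comment> \<open>Completeness is used along one sequence in the interval; comparing
    \<open>w s\<close> with \<open>w (X n)\<close> then yields the bound, and with it the full
    one-sided limit.\<close>
  define X where "X n = d / 2 / real (Suc n)" for n
  have X: "0 < X n" "X n < d" for n
    using d by (auto simp: X_def field_simps intro!: add_pos_nonneg)
  have X0: "X \<longlonglongrightarrow> 0" unfolding X_def
    by (rule LIMSEQ_Suc[OF lim_const_over_n])
  have Xk: "(\<lambda>n. X n powr \<kappa>) \<longlonglongrightarrow> 0"
    using tendsto_powr'[OF X0 tendsto_const, of \<kappa>] kappa
      always_eventually[of "\<lambda>n. 0 \<le> X n"] X(1)[THEN less_imp_le] by auto
  have diff': "\<bar>w b - w a\<bar> \<le> L * \<bar>b powr \<kappa> - a powr \<kappa>\<bar>" if "0 < a" "a < d" "0 < b" "b < d" for a b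
  proof (cases "a \<le> b")
    case True
    then show ?thesis using diff[of a b] that kappa
      by (smt (verit) L abs_ge_self mult_left_mono)
  next
    case False
    then show ?thesis using diff[of b a] that kappa
      by (smt (verit) L abs_ge_self mult_left_mono)
  qed
  have "Cauchy (\<lambda>n. w (X n))"
  proof (rule CauchyI)
    fix \<epsilon> :: real assume "0 < \<epsilon>"
    have "Cauchy (\<lambda>n. L * X n powr \<kappa>)" using tendsto_mult[OF tendsto_const Xk]
      by (rule LIMSEQ_imp_Cauchy)
    then obtain M where M: "\<forall>m\<ge>M. \<forall>n\<ge>M. norm (L * X m powr \<kappa> - L * X n powr \<kappa>) < \<epsilon>"
      using CauchyD \<open>0 < \<epsilon>\<close> by blast
    have "norm (w (X m) - w (X n)) < \<epsilon>" if "M \<le> m" "M \<le> n" for m n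
    proof -
      have "norm (w (X m) - w (X n)) \<le> L * \<bar>X m powr \<kappa> - X n powr \<kappa>\<bar>"
        using diff' X by simp
      also have "\<dots> = norm (L * X m powr \<kappa> - L * X n powr \<kappa>)"
        using L by (simp flip: right_diff_distrib add: abs_mult)
      also have "\<dots> < \<epsilon>" using M that by blast
      finally show ?thesis .
    qed
    then show "\<exists>M. \<forall>m\<ge>M. \<forall>n\<ge>M. norm (w (X m) - w (X n)) < \<epsilon>" by blast
  qed
  then obtain w0 where w0: "(\<lambda>n. w (X n)) \<longlonglongrightarrow> w0"
    using Cauchy_convergent convergent_def by blast
  have bound: "\<bar>w s - w0\<bar> \<le> L * s powr \<kappa>" if s: "0 < s" "s < d" for s
  proof (rule tendsto_le[OF sequentially_bot])
    show "(\<lambda>n. L * \<bar>s powr \<kappa> - X n powr \<kappa>\<bar>) \<longlonglongrightarrow> L * s powr \<kappa>"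
      using tendsto_mult[OF tendsto_const tendsto_rabs[OF tendsto_diff[OF tendsto_const Xk]], of L "s powr \<kappa>"]
      by simp
    show "(\<lambda>n. \<bar>w s - w (X n)\<bar>) \<longlonglongrightarrow> \<bar>w s - w0\<bar>"
      by (intro tendsto_intros w0)
  qed (use diff' X s in auto)
  have "((\<lambda>s. w s - w0) \<longlongrightarrow> 0) (at_right 0)"
  proof (rule Lim_null_comparison)
    show "\<forall>\<^sub>F s in at_right 0. norm (w s - w0) \<le> L * s powr \<kappa>"
      using bound d by (auto simp: eventually_at_right_field)
    show "((\<lambda>s. L * s powr \<kappa>) \<longlongrightarrow> 0) (at_right 0)"
      using tendsto_mult[OF tendsto_const powr_tendsto_0_at_right[OF kappa]] by simp
  qed
  then have "(w \<longlongrightarrow> w0) (at_right 0)" by (rule LIM_zero_cancel)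
  with bound that show thesis unfolding L_def e_def by blast
qed

text \<open>\<open>boundary_limit\<close> needs a right-hand side bounded independently of
  \<open>w\<close>. Here it grows linearly in \<open>w\<close>, so \<open>w\<close> has to be
  bounded first.\<close>

lemma bounded_near_boundary:
  fixes \<beta> \<kappa> d K :: real and w w' D' :: "real \<Rightarrow> real"
  assumes beta: "1/2 < \<beta>" and kappa: "0 < \<kappa>" and d: "0 < d" and K: "0 \<le> K"
    and w: "\<And>s. 0 < s \<Longrightarrow> s < d \<Longrightarrow> (w has_real_derivative w' s) (at s)"
    and D: "\<And>s. 0 < s \<Longrightarrow> s < d \<Longrightarrow> ((\<lambda>s. s powr (2*\<beta>) * w' s) has_real_derivative D' s) (at s)"
    and pos: "\<And>s. 0 < s \<Longrightarrow> s < d \<Longrightarrow> 0 \<le> w s"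
    and le: "\<And>s. 0 < s \<Longrightarrow> s < d \<Longrightarrow> \<bar>D' s\<bar> \<le> K * s powr (2*\<beta> + \<kappa> - 2) * (1 + w s)"
    and lim: "((\<lambda>s. s powr (2*\<beta> - 1) * w s) \<longlongrightarrow> 0) (at_right 0)"
  obtains B e where "0 < e" "e < d" "\<And>s. 0 < s \<Longrightarrow> s \<le> e \<Longrightarrow> w s \<le> B"
proof -
  define k where "k = 2*\<beta> - 1"
  have k: "0 < k" using beta by (simp add: k_def)
  \<comment> \<open>Integrating the bound on \<open>w'\<close> twice-estimated below gives at most
    \<open>c * e powr \<kappa>\<close> times \<open>M\<close> times the weight. Choosing
    \<open>e\<close> with \<open>c * e powr \<kappa> \<le> 1/2\<close> permits absorption, and the
    choice does not involve \<eta>.\<close>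
  define c where "c = K / \<kappa> * (1/\<kappa> + 1/k)"
  have "((\<lambda>s. c * s powr \<kappa>) \<longlongrightarrow> c * 0) (at_right 0)"
    by (intro tendsto_intros powr_tendsto_0_at_right kappa)
  then have "\<forall>\<^sub>F s in at_right 0. c * s powr \<kappa> < 1/2"
    by (rule order_tendstoD) simp
  moreover have "\<forall>\<^sub>F s in at_right 0. 0 < s \<and> s < d"
    using d by (auto simp: eventually_at_right_field)
  ultimately have "\<forall>\<^sub>F s in at_right 0. c * s powr \<kappa> < 1/2 \<and> 0 < s \<and> s < d"
    by eventually_elim simp
  then obtain e where e: "c * e powr \<kappa> \<le> 1/2" "0 < e" "e < d"
    using eventually_happens'[OF trivial_limit_at_right_real] by force
  have main: "1 + w t \<le> 2 * (1 + w e) * (1 + \<eta> * t powr (-k))" if eta: "0 < \<eta>" and t: "0 < t" "t \<le> e" for \<eta> t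
  proof -
    define q where "q s = (1 + w s) / (1 + \<eta> * s powr (-k))" for s
    define M where "M = (SUP s\<in>{0<..e}. q s)"
    have den: "0 < 1 + \<eta> * s powr (-k)" for s
      using eta by (intro add_pos_nonneg) auto
    have "((\<lambda>s. s powr k + s powr k * w s) \<longlongrightarrow> 0 + 0) (at_right 0)"
      using lim by (intro tendsto_add powr_tendsto_0_at_right k) (simp add: k_def)
    then have "\<forall>\<^sub>F s in at_right 0. s powr k + s powr k * w s < 1"
      by (rule order_tendstoD) simp
    then obtain a where a: "0 < a" "\<And>s. 0 < s \<Longrightarrow> s < a \<Longrightarrow> s powr k + s powr k * w s < 1"
      by (auto simp: eventually_at_right_field)
    \<comment> \<open>Close to \<open>0\<close> the weight dominates, since
      \<open>1 + w s \<le> s powr (-k)\<close>. The bound degenerates as \<eta> tends to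
      \<open>0\<close>, but it serves only to make the supremum finite.\<close>
    have near: "q s \<le> 1 / \<eta>" if "0 < s" "s < a" for s
    proof -
      have "1 + w s = s powr (-k) * (s powr k + s powr k * w s)"
        using that by (simp add: distrib_left powr_minus)
      also have "\<dots> \<le> s powr (-k) * 1"
        using a(2)[OF that] by (intro mult_left_mono) auto
      also have "\<dots> \<le> (1 + \<eta> * s powr (-k)) / \<eta>"
        using eta by (simp add: field_simps)
      finally show ?thesis using den[of s] by (simp add: q_def field_simps)
    qed
    have "continuous_on {a..e} w"
      using a e by (intro continuous_at_imp_continuous_on ballI DERIV_isCont[OF w]) auto
    then have "bounded (w ` {a..e})"
      by (intro compact_imp_bounded compact_continuous_image) auto
    then obtain M2 where M2: "\<And>s. a \<le> s \<Longrightarrow> s \<le> e \<Longrightarrow> \<bar>w s\<bar> \<le> M2"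
      by (force simp: bounded_iff)
    have far: "q s \<le> 1 + M2" if "a \<le> s" "s \<le> e" for s
    proof -
      have "0 \<le> w s" using pos[of s] that a e by auto
      then have "(1 + w s) * 1 \<le> (1 + w s) * (1 + \<eta> * s powr (-k))"
        using eta by (intro mult_left_mono) auto
      then have "q s \<le> 1 + w s" using den[of s] by (simp add: q_def field_simps)
      then show ?thesis using M2[OF that] by simp
    qed
    \<comment> \<open>Boundedness is what makes the real-valued \<open>SUP\<close> a genuine upper
      bound of \<open>q\<close>.\<close>
    have bdd: "bdd_above (q ` {0<..e})"
    proof (rule bdd_aboveI2)
      fix s assume "s \<in> {0<..e}"
      then show "q s \<le> max (1 / \<eta>) (1 + M2)"
        using near[of s] far[of s] by (cases "s < a") auto
    qed
    have q_le: "q s \<le> M" if "0 < s" "s \<le> e" for s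
      unfolding M_def by (rule cSUP_upper[OF _ bdd]) (use that in auto)
    then have v_le: "1 + w s \<le> M * (1 + \<eta> * s powr (-k))" if "0 < s" "s \<le> e" for s
      using q_le[OF that] den[of s] by (simp add: q_def field_simps)
    have "0 \<le> q e" using pos[of e] e den[of e] by (simp add: q_def)
    then have M: "0 \<le> M" using q_le[of e] e by simp
    have w': "\<bar>w' s\<bar> \<le> K * M / \<kappa> * (s powr (\<kappa> - 1) + \<eta> * e powr \<kappa> * s powr (-k-1))"
      if s: "0 < s" "s \<le> e" for s
    proof -
      have "s powr (2*\<beta>) * \<bar>w' s\<bar> \<le> K * M * (s powr (k + \<kappa>) / (k + \<kappa>) + \<eta> * (s powr \<kappa> / \<kappa>))"
      proof (rule abs_flux_le[OF beta w D _ _ _ lim s(1),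
            where G' = "\<lambda>s. K * M * (s powr (k + \<kappa> - 1) + \<eta> * s powr (\<kappa> - 1))"])
        fix t assume t: "0 < t" "t \<le> s"
        show "((\<lambda>s. K * M * (s powr (k + \<kappa>) / (k + \<kappa>) + \<eta> * (s powr \<kappa> / \<kappa>))) has_real_derivative
            K * M * (t powr (k + \<kappa> - 1) + \<eta> * t powr (\<kappa> - 1))) (at t)"
          using t k kappa by (intro DERIV_cmult DERIV_add has_real_derivative_powr_divide) auto
        have "\<bar>D' t\<bar> \<le> K * t powr (k + \<kappa> - 1) * (1 + w t)"
          using le[of t] t s e by (simp add: k_def algebra_simps)
        also have "\<dots> \<le> K * t powr (k + \<kappa> - 1) * (M * (1 + \<eta> * t powr (-k)))"
          using v_le[of t] t s K by (intro mult_left_mono) auto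
        also have "\<dots> = K * M * (t powr (k + \<kappa> - 1) + \<eta> * (t powr (k + \<kappa> - 1) * t powr (-k)))"
          by (simp add: algebra_simps)
        also have "t powr (k + \<kappa> - 1) * t powr (-k) = t powr (\<kappa> - 1)"
          by (simp flip: powr_add)
        finally show "\<bar>D' t\<bar> \<le> K * M * (t powr (k + \<kappa> - 1) + \<eta> * t powr (\<kappa> - 1))" .
      qed (use s e K M k kappa eta in auto)
      also have "\<dots> \<le> K * M * (s powr (k + \<kappa>) / \<kappa> + \<eta> * (s powr \<kappa> / \<kappa>))"
        using k kappa K M by (intro mult_left_mono add_right_mono divide_left_mono) auto
      also have "\<dots> = K * M / \<kappa> * (s powr (k + \<kappa>) + \<eta> * s powr \<kappa>)"
        using kappa by (simp add: field_simps)
      \<comment> \<open>A deliberate loss: after division by \<open>s powr (2*\<beta>)\<close> the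
        second term becomes a multiple of \<open>s powr (-k-1)\<close>, whose antiderivative
        reproduces the weight. Keeping \<open>s powr \<kappa>\<close> would require cases according
        to the sign of \<open>\<kappa> - k\<close>.\<close>
      also have "\<dots> \<le> K * M / \<kappa> * (s powr (k + \<kappa>) + \<eta> * e powr \<kappa>)"
        using k kappa K M eta s by (intro mult_left_mono add_left_mono powr_mono2) auto
      also have "\<dots> = s powr (2*\<beta>) * (K * M / \<kappa> * (s powr (\<kappa> - 1) + \<eta> * e powr \<kappa> * s powr (-k-1)))"
      proof -
        have "s powr (2*\<beta>) * s powr (\<kappa> - 1) = s powr (k + \<kappa>)" "s powr (2*\<beta>) * s powr (-k-1) = 1"
          using s by (simp_all add: k_def algebra_simps flip: powr_add)
        moreover have "s powr (2*\<beta>) * (K * M / \<kappa> * (s powr (\<kappa> - 1) + \<eta> * e powr \<kappa> * s powr (-k-1))) =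
          K * M / \<kappa> * (s powr (2*\<beta>) * s powr (\<kappa> - 1) + \<eta> * e powr \<kappa> * (s powr (2*\<beta>) * s powr (-k-1)))"
          by (simp add: distrib_left mult.assoc mult.left_commute)
        ultimately show ?thesis by (simp only: mult_1_right)
      qed
      finally have "s powr (2*\<beta>) * \<bar>w' s\<bar> \<le>
        s powr (2*\<beta>) * (K * M / \<kappa> * (s powr (\<kappa> - 1) + \<eta> * e powr \<kappa> * s powr (-k-1)))" .
      then show ?thesis by (rule mult_left_le_imp_le) (use s in simp)
    qed
    have step: "q t \<le> (1 + w e) + M / 2" if t: "0 < t" "t \<le> e" for t
    proof -
      define H where "H s = K * M / \<kappa> * (s powr \<kappa> / \<kappa> + \<eta> * e powr \<kappa> * (s powr (-k) / (-k)))" for s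
      have "- w e - - w t \<le> H e - H t"
      proof (rule diff_le_diff_of_deriv_le[OF t(2), where f = "\<lambda>s. - w s" and f' = "\<lambda>s. - w' s"
            and g' = "\<lambda>s. K * M / \<kappa> * (s powr (\<kappa> - 1) + \<eta> * e powr \<kappa> * s powr (-k-1))"])
        fix s assume s: "t \<le> s" "s \<le> e"
        show "((\<lambda>s. - w s) has_real_derivative - w' s) (at s)"
          using s t e by (intro DERIV_minus w) auto
        show "(H has_real_derivative K * M / \<kappa> * (s powr (\<kappa> - 1) + \<eta> * e powr \<kappa> * s powr (-k-1))) (at s)"
          unfolding H_def using s t k kappa
          by (intro DERIV_cmult DERIV_add has_real_derivative_powr_divide) auto
        show "- w' s \<le> K * M / \<kappa> * (s powr (\<kappa> - 1) + \<eta> * e powr \<kappa> * s powr (-k-1))"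
          using w'[of s] s t by linarith
      qed
      also have "H e - H t = K * M / \<kappa> * ((e powr \<kappa> - t powr \<kappa>) / \<kappa> + \<eta> * e powr \<kappa> * ((t powr (-k) - e powr (-k)) / k))"
        by (simp add: H_def algebra_simps diff_divide_distrib)
      also have "\<dots> \<le> K * M / \<kappa> * (e powr \<kappa> / \<kappa> + \<eta> * e powr \<kappa> * (t powr (-k) / k))"
        using K M kappa k eta by (intro mult_left_mono add_mono divide_right_mono) auto
      also have "\<dots> \<le> K * M / \<kappa> * ((1/\<kappa> + 1/k) * e powr \<kappa> * (1 + \<eta> * t powr (-k)))"
      proof (rule mult_left_mono)
        have "0 \<le> e powr \<kappa> / k" "0 \<le> \<eta> * e powr \<kappa> * t powr (-k) / \<kappa>"
          using k kappa eta by auto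
        moreover have "(1/\<kappa> + 1/k) * e powr \<kappa> * (1 + \<eta> * t powr (-k)) =
          e powr \<kappa> / \<kappa> + \<eta> * e powr \<kappa> * (t powr (-k) / k) + (e powr \<kappa> / k + \<eta> * e powr \<kappa> * t powr (-k) / \<kappa>)"
          by (simp add: algebra_simps)
        ultimately show "e powr \<kappa> / \<kappa> + \<eta> * e powr \<kappa> * (t powr (-k) / k)
          \<le> (1/\<kappa> + 1/k) * e powr \<kappa> * (1 + \<eta> * t powr (-k))" by linarith
      qed (use K M kappa in auto)
      also have "\<dots> = (c * e powr \<kappa>) * (M * (1 + \<eta> * t powr (-k)))"
        by (simp add: c_def algebra_simps)
      also have "\<dots> \<le> 1/2 * (M * (1 + \<eta> * t powr (-k)))"
        using e M den[of t] by (intro mult_right_mono) auto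
      finally have "1 + w t \<le> (1 + w e) * 1 + M / 2 * (1 + \<eta> * t powr (-k))" by simp
      also have "\<dots> \<le> (1 + w e) * (1 + \<eta> * t powr (-k)) + M / 2 * (1 + \<eta> * t powr (-k))"
        using pos[of e] e eta by (intro add_right_mono mult_left_mono) auto
      finally show ?thesis using den[of t] by (simp add: q_def field_simps)
    qed
    \<comment> \<open>\<open>step\<close> bounds every \<open>q t\<close>, hence the supremum.
      Absorbing \<open>M / 2\<close> produces the factor \<open>2\<close> in
      \<open>main\<close>.\<close>
    have "M \<le> (1 + w e) + M / 2"
      unfolding M_def using e by (intro cSUP_least step[unfolded M_def]) auto
    then have "M \<le> 2 * (1 + w e)" by simp
    then have "M * (1 + \<eta> * t powr (-k)) \<le> 2 * (1 + w e) * (1 + \<eta> * t powr (-k))"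
      using den[of t] by (intro mult_right_mono) auto
    with v_le[OF t] show ?thesis by linarith
  qed
  have "w t \<le> 2 * (1 + w e)" if t: "0 < t" "t \<le> e" for t
  proof -
    have "1 + w t \<le> 2 * (1 + w e) * (1 + 0 * t powr (-k))"
    proof (rule tendsto_lowerbound)
      show "((\<lambda>\<eta>. 2 * (1 + w e) * (1 + \<eta> * t powr (-k))) \<longlongrightarrow> 2 * (1 + w e) * (1 + 0 * t powr (-k))) (at_right 0)"
        by (intro tendsto_intros)
      show "\<forall>\<^sub>F \<eta> in at_right 0. 1 + w t \<le> 2 * (1 + w e) * (1 + \<eta> * t powr (-k))"
        using eventually_at_right_less[of 0] by eventually_elim (rule main[OF _ t])
    qed simp
    then show ?thesis by simp
  qed
  with e that show thesis by blast
qed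

text \<open>The sublinear power is first estimated by \<open>x powr p \<le> 1 + x\<close> to bound
  \<open>w\<close>. With \<open>w\<close> bounded, \<open>boundary_limit\<close> applies with a
  constant \<open>K\<close>; if the limit is zero, it is applied again on shorter intervals, where
  the coefficient is small.\<close>

lemma weighted_limit:
  fixes \<beta> \<kappa> p d C :: real and w w' D' :: "real \<Rightarrow> real"
  assumes beta: "1/2 < \<beta>" and kappa: "0 < \<kappa>" and p: "0 < p" "p < 1" and d: "0 < d" and C: "0 \<le> C"
    and w: "\<And>s. 0 < s \<Longrightarrow> s < d \<Longrightarrow> (w has_real_derivative w' s) (at s)"
    and D: "\<And>s. 0 < s \<Longrightarrow> s < d \<Longrightarrow> ((\<lambda>s. s powr (2*\<beta>) * w' s) has_real_derivative D' s) (at s)"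
    and pos: "\<And>s. 0 < s \<Longrightarrow> s < d \<Longrightarrow> 0 \<le> w s"
    and le: "\<And>s. 0 < s \<Longrightarrow> s < d \<Longrightarrow> \<bar>D' s\<bar> \<le> C * (w s powr p + w s) * s powr (2*\<beta> + \<kappa> - 2)"
    and lim: "((\<lambda>s. s powr (2*\<beta> - 1) * w s) \<longlongrightarrow> 0) (at_right 0)"
  obtains w0 where "(w \<longlongrightarrow> w0) (at_right 0)"
    and "(\<lambda>s. w s - w0) \<in> O[at_right 0](\<lambda>s. s powr \<kappa>)"
    and "w0 = 0 \<Longrightarrow> w \<in> o[at_right 0](\<lambda>s. s powr \<kappa>)"
proof -
  have powr_le: "x powr p \<le> 1 + x" if "0 \<le> x" for x :: real
  proof (cases "x \<le> 1")
    case True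
    then have "x powr p \<le> 1 powr p" using that p by (intro powr_mono2) auto
    then show ?thesis using that by simp
  next
    case False
    then have "x powr p \<le> x powr 1" using p by (intro powr_mono) auto
    then show ?thesis using that by simp
  qed
  obtain B e where e: "0 < e" "e < d" and B: "\<And>s. 0 < s \<Longrightarrow> s \<le> e \<Longrightarrow> w s \<le> B"
  proof (rule bounded_near_boundary[OF beta kappa d _ w D pos _ lim, where K = "2 * C"])
    fix s assume s: "0 < s" "s < d"
    have "C * (w s powr p + w s) * s powr (2*\<beta> + \<kappa> - 2) \<le> C * (2 * (1 + w s)) * s powr (2*\<beta> + \<kappa> - 2)"
      using powr_le[OF pos[OF s]] C pos[OF s] by (intro mult_right_mono mult_left_mono) auto
    with le[OF s] show "\<bar>D' s\<bar> \<le> 2 * C * s powr (2*\<beta> + \<kappa> - 2) * (1 + w s)"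
      by (simp add: algebra_simps)
  qed (use C in auto)
  have B0: "0 \<le> B" using B[of e] pos[of e] e by auto
  have near: "\<bar>D' s\<bar> \<le> K * s powr (2*\<beta> + \<kappa> - 2)"
    if "0 < s" "s < d" "C * (w s powr p + w s) \<le> K" for s K
    using le[OF that(1,2)] mult_right_mono[OF that(3), of "s powr (2*\<beta> + \<kappa> - 2)"] by simp
  define E where "E = \<kappa> * (2*\<beta> + \<kappa> - 1)"
  have E: "0 < E" using beta kappa by (simp add: E_def)
  define K where "K = C * (B powr p + B)"
  have K: "0 \<le> K" using C B0 by (simp add: K_def)
  obtain w0 where w0: "(w \<longlongrightarrow> w0) (at_right 0)"
    and bound: "\<And>s. 0 < s \<Longrightarrow> s < e \<Longrightarrow> \<bar>w s - w0\<bar> \<le> K / E * s powr \<kappa>"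
  proof (rule boundary_limit[OF beta kappa e(1) K w D _ lim, folded E_def])
    fix s assume s: "0 < s" "s < e"
    show "\<bar>D' s\<bar> \<le> K * s powr (2*\<beta> + \<kappa> - 2)"
      unfolding K_def using s e B[of s] pos[of s] C p
      by (intro near mult_left_mono add_mono powr_mono2) auto
  qed (use e in auto)
  have bigo: "(\<lambda>s. w s - w0) \<in> O[at_right 0](\<lambda>s. s powr \<kappa>)"
  proof (rule bigoI[where c = "K / E"])
    show "\<forall>\<^sub>F s in at_right 0. norm (w s - w0) \<le> K / E * norm (s powr \<kappa>)"
      using bound e by (auto simp: eventually_at_right_field)
  qed
  have "w \<in> o[at_right 0](\<lambda>s. s powr \<kappa>)" if [simp]: "w0 = 0"
  proof (rule landau_o.smallI)
    fix c :: real assume c: "0 < c"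
    have "\<forall>\<^sub>F s in at_right 0. 0 \<le> w s"
      using pos d by (auto simp: eventually_at_right_field)
    \<comment> \<open>Since \<open>p > 0\<close>, the coefficient vanishes together with
      \<open>w\<close>. The threshold \<open>c * E\<close> is chosen so that division by the
      \<open>E\<close> of \<open>boundary_limit\<close> leaves exactly \<open>c\<close>.\<close>
    then have "((\<lambda>s. C * (w s powr p + w s)) \<longlongrightarrow> C * (0 powr p + 0)) (at_right 0)"
      using w0 p by (intro tendsto_mult tendsto_add tendsto_powr' tendsto_const) auto
    then have "\<forall>\<^sub>F s in at_right 0. C * (w s powr p + w s) < c * E"
      using c E by (intro order_tendstoD) auto
    then obtain b where b: "0 < b" "\<And>s. 0 < s \<Longrightarrow> s < b \<Longrightarrow> C * (w s powr p + w s) < c * E"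
      by (auto simp: eventually_at_right_field)
    define b' where "b' = min b d"
    have b': "0 < b'" "b' \<le> b" "b' \<le> d" using b d by (auto simp: b'_def)
    have cE: "0 \<le> c * E" using c E by simp
    obtain w1 where w1: "(w \<longlongrightarrow> w1) (at_right 0)"
      and bound: "\<And>s. 0 < s \<Longrightarrow> s < b' \<Longrightarrow> \<bar>w s - w1\<bar> \<le> c * E / E * s powr \<kappa>"
    proof (rule boundary_limit[OF beta kappa b'(1) cE w D _ lim, folded E_def])
      fix s assume s: "0 < s" "s < b'"
      show "\<bar>D' s\<bar> \<le> c * E * s powr (2*\<beta> + \<kappa> - 2)"
        using s b' b(2)[of s] by (intro near) auto
    qed (use b' in auto)
    have "w1 = 0" using tendsto_unique[OF _ w1 w0] by simp
    then show "\<forall>\<^sub>F s in at_right 0. norm (w s) \<le> c * norm (s powr \<kappa>)"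
      using bound b' E by (auto simp: eventually_at_right_field)
  qed
  with w0 bigo that show thesis by blast
qed

section \<open>Expansion of a solution in a boundary collar\<close>

lemma powr_bigo_powr_at_right_0:
  fixes a b :: real
  assumes "a \<le> b"
  shows "(\<lambda>s. s powr b) \<in> O[at_right 0](\<lambda>s. s powr a)"
proof (rule bigoI[where c = 1])
  have "\<forall>\<^sub>F s::real in at_right 0. 0 < s \<and> s < 1"
    by (auto simp: eventually_at_right_field intro: exI[of _ 1])
  then show "\<forall>\<^sub>F s::real in at_right 0. norm (s powr b) \<le> 1 * norm (s powr a)"
    by eventually_elim (use assms in \<open>auto intro: powr_mono'\<close>)
qed

lemma at_within_atLeast_eq_at_right: "at a within {a..} = at_right (a::real)"
proof -
  have "{a..} - {a} = {a<..} - {a}" by auto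
  then show ?thesis by (simp add: at_within_def)
qed

text \<open>Assumption \<open>mu\<close> says that \<beta> solves the indicial equation, so the
  singular potential cancels from the flux equation; \<open>1 - \<beta>\<close> is the other,
  smaller root. The radius at distance \<open>s\<close> is \<open>b + \<sigma> * s\<close>, so
  \<sigma> covers both kinds of sphere and enters the first-order term by the chain rule.\<close>

lemma collar_expansion:
  fixes m \<beta> \<mu> p b \<sigma> d :: real and u u' u'' :: "real \<Rightarrow> real"
  assumes beta: "1/2 < \<beta>" and mu: "\<beta> * (1 - \<beta>) = \<mu>" and p: "0 < p" "p < 1"
    and kappa: "0 < 2 - \<beta> * (1 - p)"
    and m: "0 \<le> m" and b: "0 < b" and sigma: "\<bar>\<sigma>\<bar> = 1" and d: "0 < d"
    and pos: "\<And>s. 0 < s \<Longrightarrow> s < d \<Longrightarrow> 0 < u s"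
    and u: "\<And>s. 0 < s \<Longrightarrow> s < d \<Longrightarrow> (u has_real_derivative u' s) (at s)"
    and u': "\<And>s. 0 < s \<Longrightarrow> s < d \<Longrightarrow> (u' has_real_derivative u'' s) (at s)"
    and eq: "\<And>s. 0 < s \<Longrightarrow> s < d \<Longrightarrow>
      u'' s + \<sigma> * (2 * m) / (b + \<sigma> * s) * u' s + \<mu> / s^2 * u s = u s powr p"
    and lim: "((\<lambda>s. u s / s powr (1 - \<beta>)) \<longlongrightarrow> 0) (at_right 0)"
  obtains w0 where "((\<lambda>s. u s / s powr \<beta>) \<longlongrightarrow> w0) (at_right 0)"
    and "(\<lambda>s. u s / s powr \<beta> - w0) \<in> O[at_right 0](\<lambda>s. s powr (min 1 (2 - \<beta> * (1 - p))))"
    and "1 < 2 - \<beta> * (1 - p) \<Longrightarrow> has_boundary_derivative (\<lambda>s. u s / s powr \<beta>) w0 (- (m * \<sigma>) / b * w0)"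
    and "w0 = 0 \<Longrightarrow> (\<lambda>s. u s / s powr \<beta>) \<in> o[at_right 0](\<lambda>s. s powr (min 1 (2 - \<beta> * (1 - p))))"
proof -
  define \<kappa> where "\<kappa> = 2 - \<beta> * (1 - p)"
  have kappa0: "0 < \<kappa>" using kappa by (simp add: \<kappa>_def)
  have kappa2: "\<kappa> < 2" using p beta by (simp add: \<kappa>_def)
  \<comment> \<open>The bound \<open>b / 2\<close> keeps the radius between \<open>b / 2\<close> and
    \<open>2 * b\<close> for either sign; the bound \<open>1\<close> allows powers of
    \<open>s\<close> to be compared by their exponents.\<close>
  define d1 where "d1 = min d (min 1 (b / 2))"
  have d1: "0 < d1" "d1 \<le> d" "d1 \<le> 1" "d1 \<le> b / 2" using d b by (auto simp: d1_def)
  define r where "r s = b + \<sigma> * s" for s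
  have "\<sigma> = 1 \<or> \<sigma> = -1" using sigma by linarith
  then have r: "b / 2 \<le> r s" "r s \<le> 2 * b" if "0 \<le> s" "s < d1" for s
    using that d1 b by (auto simp: r_def)
  have r_pos: "0 < r s" if "0 \<le> s" "s < d1" for s using r(1)[OF that] b by linarith
  have r_deriv: "(r has_real_derivative \<sigma>) (at s within A)" for s A
    unfolding r_def by (auto intro!: derivative_eq_intros)
  have r_powr_deriv: "((\<lambda>s. r s powr a) has_real_derivative a * r s powr (a - 1) * \<sigma>) (at s within A)"
    if "0 < r s" for a s A
    by (rule DERIV_chain2[OF has_real_derivative_powr[OF that] r_deriv])
  have r0: "r 0 = b" by (simp add: r_def)
  have sigma2: "\<sigma> * \<sigma> = 1" using \<open>\<sigma> = 1 \<or> \<sigma> = -1\<close> by auto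
  define W where "W s = r s powr m * (u s / s powr \<beta>)" for s
  define W' where "W' s = r s powr m * s powr (-\<beta>) * (u' s + (m * \<sigma> / r s - \<beta> / s) * u s)" for s
  \<comment> \<open>\<open>D'\<close> is the derivative of the flux with \<open>u''\<close> already
    eliminated by the equation.\<close>
  define D' where "D' s = r s powr m * s powr \<beta> * (u s powr p + m * (m - 1) / (r s)^2 * u s)" for s
  have u_eq: "u s = W s * s powr \<beta> * r s powr (-m)" if "0 < s" "s < d1" for s
    using that r_pos[of s] by (simp add: W_def powr_minus)
  have W_pos: "0 < W s" if "0 < s" "s < d1" for s
    using that r_pos[of s] pos[of s] d1 by (simp add: W_def)
  have W_deriv: "(W has_real_derivative W' s) (at s)" if s: "0 < s" "s < d1" for s
  proof -
    have rs: "0 < r s" using r_pos s by simp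
    have "((\<lambda>s. r s powr m * (u s * s powr (-\<beta>))) has_real_derivative
       (m * r s powr (m - 1) * \<sigma>) * (u s * s powr (-\<beta>)) +
       (u' s * s powr (-\<beta>) + (-\<beta> * s powr (-\<beta> - 1)) * u s) * r s powr m) (at s)"
      using s d1 by (intro DERIV_mult r_powr_deriv rs u has_real_derivative_powr) auto
    moreover have "r s powr (m - 1) = r s powr m / r s" "s powr (-\<beta> - 1) = s powr (-\<beta>) / s"
      using s rs by (simp_all add: powr_diff)
    ultimately show ?thesis
      by (simp add: W_def[abs_def] W'_def powr_minus divide_inverse algebra_simps)
  qed
  have D_deriv: "((\<lambda>s. s powr (2*\<beta>) * W' s) has_real_derivative D' s) (at s)" if s: "0 < s" "s < d1" for s
  proof -
    have rs: "0 < r s" using r_pos s by simp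
    \<comment> \<open>\<open>Q\<close> is the bracket in \<open>W'\<close>. The flux equals
      \<open>r s powr m * s powr \<beta> * Q s\<close>, the form that is differentiated.\<close>
    define Q where "Q s = u' s + (m * \<sigma> / r s - \<beta> / s) * u s" for s
    define Q' where "Q' = u'' s + ((m * \<sigma> / r s - \<beta> / s) * u' s + (\<beta> / s^2 - m / (r s)^2) * u s)"
    have "((\<lambda>s. m * \<sigma> / r s - \<beta> / s) has_real_derivative
        (0 * r s - m * \<sigma> * \<sigma>) / (r s * r s) - (0 * s - \<beta> * 1) / (s * s)) (at s)"
      using s rs by (intro DERIV_diff DERIV_divide r_deriv DERIV_const DERIV_ident) auto
    moreover have "(0 * r s - m * \<sigma> * \<sigma>) / (r s * r s) - (0 * s - \<beta> * 1) / (s * s)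
        = \<beta> / s^2 - m / (r s)^2"
      by (simp add: power2_eq_square mult.assoc sigma2)
    ultimately have P: "((\<lambda>s. m * \<sigma> / r s - \<beta> / s) has_real_derivative (\<beta> / s^2 - m / (r s)^2)) (at s)"
      by simp
    have "(Q has_real_derivative u'' s + ((\<beta> / s^2 - m / (r s)^2) * u s + u' s * (m * \<sigma> / r s - \<beta> / s))) (at s)"
      unfolding Q_def[abs_def] using s d1 by (intro DERIV_add DERIV_mult P u u') auto
    then have Q: "(Q has_real_derivative Q') (at s)"
      by (simp add: Q'_def algebra_simps)
    have "((\<lambda>s. r s powr m * s powr \<beta> * Q s) has_real_derivative
       ((m * r s powr (m - 1) * \<sigma>) * s powr \<beta> + (\<beta> * s powr (\<beta> - 1)) * r s powr m) * Q s
        + Q' * (r s powr m * s powr \<beta>)) (at s)"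
      using s by (intro DERIV_mult r_powr_deriv rs Q has_real_derivative_powr) auto
    also have "((m * r s powr (m - 1) * \<sigma>) * s powr \<beta> + (\<beta> * s powr (\<beta> - 1)) * r s powr m) * Q s
        + Q' * (r s powr m * s powr \<beta>) = r s powr m * s powr \<beta> * ((m * \<sigma> / r s + \<beta> / s) * Q s + Q')"
      using s rs by (simp add: powr_diff algebra_simps)
    also have "(m * \<sigma> / r s + \<beta> / s) * Q s + Q' =
        u'' s + \<sigma> * (2 * m) / r s * u' s + (m * m * (\<sigma> * \<sigma>) / (r s)^2 - \<beta> * \<beta> / s^2 + \<beta> / s^2 - m / (r s)^2) * u s"
      using s rs by (simp add: Q_def Q'_def power2_eq_square divide_inverse algebra_simps)
    \<comment> \<open>The identity \<open>\<beta> - \<beta> * \<beta> = \<mu>\<close> turns the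
      \<open>1 / s^2\<close> terms into the potential, and \<open>\<sigma> * \<sigma> = 1\<close>
      leaves \<open>m * m - m\<close> over \<open>(r s)^2\<close>.\<close>
    also have "\<dots> = (u'' s + \<sigma> * (2 * m) / r s * u' s + \<mu> / s^2 * u s) + m * (m - 1) / (r s)^2 * u s"
      by (simp add: sigma2 flip: mu) (simp add: divide_inverse algebra_simps)
    also have "\<dots> = u s powr p + m * (m - 1) / (r s)^2 * u s"
      using eq[of s] s d1 by (simp add: r_def)
    finally have "((\<lambda>s. r s powr m * s powr \<beta> * Q s) has_real_derivative D' s) (at s)"
      by (simp add: D'_def)
    then show ?thesis
    proof (rule has_field_derivative_transform_within_open[where S = "{0<..}"])
      fix x :: real assume "x \<in> {0<..}"
      have "x powr (2*\<beta>) * W' x = r x powr m * (x powr (2*\<beta>) * x powr (-\<beta>)) * Q x"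
        by (simp only: W'_def Q_def mult_ac)
      also have "x powr (2*\<beta>) * x powr (-\<beta>) = x powr \<beta>" by (simp flip: powr_add)
      finally show "r x powr m * x powr \<beta> * Q x = x powr (2*\<beta>) * W' x" by simp
    qed (use s in auto)
  qed
  define C where "C = (2*b) powr (m * (1 - p)) + \<bar>m * (m - 1)\<bar> / (b/2)^2"
  have D'_le: "\<bar>D' s\<bar> \<le> C * (W s powr p + W s) * s powr (2*\<beta> + \<kappa> - 2)" if s: "0 < s" "s < d1" for s
  proof -
    have rs: "0 < r s" using r_pos s by simp
    note W = W_pos[OF s]
    have "r s powr m * s powr \<beta> * u s powr p
      = r s powr m * s powr \<beta> * (W s powr p * s powr (\<beta> * p) * r s powr (-m * p))"
      using u_eq[OF s] s rs W by (simp add: powr_mult powr_powr)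
    also have "\<dots> = (r s powr m * r s powr (-m * p)) * W s powr p * (s powr \<beta> * s powr (\<beta> * p))"
      by simp
    \<comment> \<open>The powers of \<open>s\<close> add up to \<open>\<beta> + \<beta> * p\<close>,
      which is \<open>2*\<beta> + \<kappa> - 2\<close> by the definition of \<kappa>.\<close>
    also have "\<dots> = r s powr (m * (1 - p)) * W s powr p * s powr (2*\<beta> + \<kappa> - 2)"
      by (simp add: \<kappa>_def algebra_simps flip: powr_add)
    also have "\<dots> \<le> (2*b) powr (m * (1 - p)) * W s powr p * s powr (2*\<beta> + \<kappa> - 2)"
      using r[of s] s rs m p by (intro mult_right_mono powr_mono2) auto
    also have "\<dots> \<le> (2*b) powr (m * (1 - p)) * (W s powr p + W s) * s powr (2*\<beta> + \<kappa> - 2)"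
      using W by (intro mult_right_mono mult_left_mono) auto
    finally have 1: "r s powr m * s powr \<beta> * u s powr p
      \<le> (2*b) powr (m * (1 - p)) * (W s powr p + W s) * s powr (2*\<beta> + \<kappa> - 2)" .
    have "r s powr m * s powr \<beta> * \<bar>m * (m - 1) / (r s)^2 * u s\<bar>
      = r s powr m * s powr \<beta> * (\<bar>m * (m - 1)\<bar> / (r s)^2 * u s)"
      using pos[of s] s d1 by (simp add: abs_mult)
    also have "\<dots> = \<bar>m * (m - 1)\<bar> / (r s)^2 * W s * (r s powr m * r s powr (-m)) * (s powr \<beta> * s powr \<beta>)"
      by (subst u_eq[OF s]) (simp add: algebra_simps)
    also have "\<dots> = \<bar>m * (m - 1)\<bar> / (r s)^2 * W s * s powr (2*\<beta>)"
      using rs by (simp flip: powr_add)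
    \<comment> \<open>The linear term carries the better power \<open>s powr (2*\<beta>)\<close>; it
      is weakened to the common one using \<open>s < 1\<close> and
      \<open>\<kappa> < 2\<close>.\<close>
    also have "\<dots> \<le> \<bar>m * (m - 1)\<bar> / (b/2)^2 * W s * s powr (2*\<beta> + \<kappa> - 2)"
      using r[of s] s rs b W d1 kappa2
      by (intro mult_mono divide_left_mono power_mono powr_mono' mult_nonneg_nonneg) auto
    also have "\<dots> \<le> \<bar>m * (m - 1)\<bar> / (b/2)^2 * (W s powr p + W s) * s powr (2*\<beta> + \<kappa> - 2)"
      using W by (intro mult_right_mono mult_left_mono) auto
    finally have 2: "r s powr m * s powr \<beta> * \<bar>m * (m - 1) / (r s)^2 * u s\<bar>
      \<le> \<bar>m * (m - 1)\<bar> / (b/2)^2 * (W s powr p + W s) * s powr (2*\<beta> + \<kappa> - 2)" .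
    have "\<bar>D' s\<bar> = r s powr m * s powr \<beta> * \<bar>u s powr p + m * (m - 1) / (r s)^2 * u s\<bar>"
      by (simp add: D'_def abs_mult)
    also have "\<dots> \<le> r s powr m * s powr \<beta> * (u s powr p + \<bar>m * (m - 1) / (r s)^2 * u s\<bar>)"
      by (intro mult_left_mono order_trans[OF abs_triangle_ineq]) auto
    also have "\<dots> \<le> C * (W s powr p + W s) * s powr (2*\<beta> + \<kappa> - 2)"
      using 1 2 by (simp add: C_def distrib_left distrib_right)
    finally show ?thesis .
  qed
  have r_tendsto: "((\<lambda>s. r s powr a) \<longlongrightarrow> b powr a) (at_right 0)" for a
    using b by (auto simp: r_def intro!: tendsto_eq_intros)
  have W_lim: "((\<lambda>s. s powr (2*\<beta> - 1) * W s) \<longlongrightarrow> 0) (at_right 0)"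
  proof -
    have "((\<lambda>s. r s powr m * (u s / s powr (1 - \<beta>))) \<longlongrightarrow> b powr m * 0) (at_right 0)"
      by (intro tendsto_mult r_tendsto lim)
    moreover have "\<forall>\<^sub>F s in at_right 0. r s powr m * (u s / s powr (1 - \<beta>)) = s powr (2*\<beta> - 1) * W s"
      using eventually_at_right_less[of 0]
    proof eventually_elim
      case (elim s)
      have "s powr (2*\<beta> - 1) * s powr (-\<beta>) = s powr (-(1 - \<beta>))"
        by (simp flip: powr_add)
      then show ?case by (simp add: W_def divide_inverse powr_minus[symmetric] algebra_simps)
    qed
    ultimately show ?thesis by (simp add: tendsto_cong)
  qed
  obtain W0 where W0: "(W \<longlongrightarrow> W0) (at_right 0)"
    and W_bigo: "(\<lambda>s. W s - W0) \<in> O[at_right 0](\<lambda>s. s powr \<kappa>)"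
    and W_smallo: "W0 = 0 \<Longrightarrow> W \<in> o[at_right 0](\<lambda>s. s powr \<kappa>)"
    using weighted_limit[OF beta kappa0 p d1(1) _ W_deriv D_deriv less_imp_le[OF W_pos] D'_le W_lim]
    by (auto simp: C_def)
  define w0 where "w0 = b powr (-m) * W0"
  define \<alpha> where "\<alpha> = min 1 \<kappa>"
  \<comment> \<open>At \<open>s = 0\<close> both sides are \<open>0\<close>, since
    \<open>0 powr \<beta>\<close> is \<open>0\<close> and division by zero gives
    \<open>0\<close>.\<close>
  have w_eq: "u s / s powr \<beta> = r s powr (-m) * W s" if "0 \<le> s" "s < d1" for s
    using r_pos[OF that] by (simp add: W_def powr_minus)
  have ev: "\<forall>\<^sub>F s in at_right 0. u s / s powr \<beta> = r s powr (-m) * W s"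
    using w_eq d1 by (auto simp: eventually_at_right_field)
  have lim0: "((\<lambda>s. u s / s powr \<beta>) \<longlongrightarrow> w0) (at_right 0)"
    unfolding w0_def using tendsto_mult[OF r_tendsto W0] by (simp add: tendsto_cong[OF ev])
  have r_bigo: "(\<lambda>s. r s powr (-m)) \<in> O[at_right 0](\<lambda>_. 1)"
    by (rule bigoI_tendsto[of _ _ "b powr (-m)"]) (use r_tendsto in auto)
  have r_pow_deriv: "((\<lambda>s. r s powr (-m)) has_real_derivative (-m * \<sigma> / b * b powr (-m))) (at 0 within {0..})"
    using r_powr_deriv[of 0 "-m" "{0..}"] b by (simp add: r0 powr_diff mult_ac)
  have "(\<lambda>s. r s powr (-m) - b powr (-m)) \<in> O[at_right 0](\<lambda>s. s powr 1)"
  proof (rule bigoI_tendsto)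
    have "((\<lambda>s. (r s powr (-m) - b powr (-m)) / s) \<longlongrightarrow> -m * \<sigma> / b * b powr (-m)) (at_right 0)"
      using r_pow_deriv by (simp add: has_field_derivative_iff r0 at_within_atLeast_eq_at_right)
    then show "((\<lambda>s. (r s powr (-m) - b powr (-m)) / s powr 1) \<longlongrightarrow> -m * \<sigma> / b * b powr (-m)) (at_right 0)"
      by (rule Lim_transform_eventually) (auto simp: eventually_at_right_field intro!: exI[of _ 1])
    show "\<forall>\<^sub>F s in at_right 0. s powr 1 \<noteq> (0::real)"
      using eventually_at_right_less[of 0] by eventually_elim simp
  qed
  then have r_diff: "(\<lambda>s. r s powr (-m) - b powr (-m)) \<in> O[at_right 0](\<lambda>s. s powr \<alpha>)"
    by (rule landau_o.big_trans) (intro powr_bigo_powr_at_right_0, simp add: \<alpha>_def)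
  have kappa_alpha: "(\<lambda>s. s powr \<kappa>) \<in> O[at_right 0](\<lambda>s. s powr \<alpha>)"
    by (intro powr_bigo_powr_at_right_0) (simp add: \<alpha>_def)
  \<comment> \<open>The error splits into \<open>r s powr (-m) * (W s - W0)\<close>, of order
    \<kappa>, and \<open>W0 * (r s powr (-m) - b powr (-m))\<close>, of order \<open>1\<close>;
    hence the minimum in \<alpha>.\<close>
  have bigo: "(\<lambda>s. u s / s powr \<beta> - w0) \<in> O[at_right 0](\<lambda>s. s powr \<alpha>)"
  proof -
    have "(\<lambda>s. r s powr (-m) * (W s - W0)) \<in> O[at_right 0](\<lambda>s. 1 * s powr \<alpha>)"
      by (intro landau_o.big.mult r_bigo landau_o.big_trans[OF W_bigo kappa_alpha])
    moreover have "(\<lambda>s. W0 * (r s powr (-m) - b powr (-m))) \<in> O[at_right 0](\<lambda>s. s powr \<alpha>)"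
      using r_diff by simp
    ultimately have "(\<lambda>s. r s powr (-m) * (W s - W0) + W0 * (r s powr (-m) - b powr (-m))) \<in> O[at_right 0](\<lambda>s. s powr \<alpha>)"
      by (intro sum_in_bigo) auto
    also have "?this \<longleftrightarrow> ?thesis"
      by (rule landau_o.big.in_cong) (use ev in eventually_elim, simp add: w0_def algebra_simps)
    finally show ?thesis .
  qed
  have smallo: "(\<lambda>s. u s / s powr \<beta>) \<in> o[at_right 0](\<lambda>s. s powr \<alpha>)" if "w0 = 0"
  proof -
    have "W0 = 0" using that b by (simp add: w0_def)
    then have "(\<lambda>s. r s powr (-m) * W s) \<in> o[at_right 0](\<lambda>s. 1 * s powr \<alpha>)"
      by (intro landau_o.big_small_mult r_bigo landau_o.small_big_trans[OF W_smallo kappa_alpha])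
    also have "?this \<longleftrightarrow> ?thesis"
      by (simp, rule landau_o.small.in_cong) (use ev in eventually_elim, simp)
    finally show ?thesis .
  qed
  have deriv: "has_boundary_derivative (\<lambda>s. u s / s powr \<beta>) w0 (- (m * \<sigma>) / b * w0)" if "1 < \<kappa>"
  proof -
    have "(\<lambda>s. s powr \<kappa>) \<in> o[at_right 0](\<lambda>s. s)"
    proof (rule smalloI_tendsto)
      have "((\<lambda>s. s powr (\<kappa> - 1)) \<longlongrightarrow> 0) (at_right 0)"
        using that by (intro powr_tendsto_0_at_right) simp
      then show "((\<lambda>s. s powr \<kappa> / s) \<longlongrightarrow> 0) (at_right 0)"
        by (rule Lim_transform_eventually)
          (auto simp: eventually_at_right_field powr_diff intro!: exI[of _ 1])
      show "\<forall>\<^sub>F s in at_right 0. s \<noteq> (0::real)"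
        using eventually_at_right_less[of 0] by eventually_elim simp
    qed
    then have "(\<lambda>s. W s - W0) \<in> o[at_right 0](\<lambda>s. s)"
      by (rule landau_o.big_small_trans[OF W_bigo])
    then have "((\<lambda>s. (W s - W0) / s) \<longlongrightarrow> 0) (at_right 0)"
      by (rule smalloD_tendsto)
    \<comment> \<open>The value \<open>W 0\<close> is \<open>0\<close> by the convention on
      division, so the boundary value is inserted by a function update.\<close>
    then have "((\<lambda>s. ((W(0 := W0)) s - (W(0 := W0)) 0) / (s - 0)) \<longlongrightarrow> 0) (at_right 0)"
      by (rule Lim_transform_eventually) (auto simp: eventually_at_right_field intro!: exI[of _ 1])
    then have "((W(0 := W0)) has_real_derivative 0) (at 0 within {0..})"
      by (simp add: has_field_derivative_iff at_within_atLeast_eq_at_right)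
    from DERIV_mult[OF r_pow_deriv this]
    have "((\<lambda>s. r s powr (-m) * (W(0 := W0)) s) has_real_derivative (- (m * \<sigma>) / b * w0)) (at 0 within {0..})"
      by (simp add: w0_def algebra_simps)
    then show ?thesis unfolding has_boundary_derivative_def
    proof (rule has_field_derivative_transform_within[OF _ d1(1)])
      fix s :: real assume "s \<in> {0..}" "dist s 0 < d1"
      then show "r s powr (-m) * (W(0 := W0)) s = ((\<lambda>s. u s / s powr \<beta>)(0 := w0)) s"
        using w_eq[of s] by (auto simp: w0_def r0)
    qed simp
  qed
  show thesis
    using that[OF lim0] bigo smallo deriv unfolding \<alpha>_def \<kappa>_def by blast
qed

section \<open>The exponent \<open>beta_plus\<close> and the thresholds for \<mu>\<close>

lemma beta_plus_gt_half: "\<mu> < 1/4 \<Longrightarrow> 1/2 < beta_plus \<mu>"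
  by (simp add: beta_plus_def)

lemma beta_plus_mult_one_minus: "\<mu> \<le> 1/4 \<Longrightarrow> beta_plus \<mu> * (1 - beta_plus \<mu>) = \<mu>"
  using real_sqrt_pow2[of "1/4 - \<mu>"] by (simp add: beta_plus_def power2_eq_square algebra_simps)

lemma one_minus_beta_plus: "1 - beta_plus \<mu> = beta_minus \<mu>"
  by (simp add: beta_plus_def beta_minus_def)

text \<open>The map taking \<open>x\<close> to \<open>x * (1 - x)\<close> strictly decreases to the
  right of \<open>1/2\<close> and has the value \<mu> at \<open>beta_plus \<mu>\<close>.\<close>

lemma beta_plus_less_iff:
  assumes "\<mu> < 1/4" "1/2 < c"
  shows "beta_plus \<mu> < c \<longleftrightarrow> c * (1 - c) < \<mu>"
proof -
  have "beta_plus \<mu> < c \<longleftrightarrow> sqrt (1/4 - \<mu>) < c - 1/2"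
    by (auto simp: beta_plus_def)
  also have "\<dots> \<longleftrightarrow> sqrt (1/4 - \<mu>) < sqrt ((c - 1/2)^2)"
    using assms by simp
  also have "\<dots> \<longleftrightarrow> c * (1 - c) < \<mu>"
    by (simp only: real_sqrt_less_iff) (auto simp: power2_eq_square algebra_simps)
  finally show ?thesis .
qed

text \<open>Take \<open>c = 2 / (1 - p)\<close> in \<open>beta_plus_less_iff\<close>: then
  \<open>c * (1 - c)\<close> is \<open>- mu_star p\<close>.\<close>

lemma kappa_pos_iff:
  assumes "\<mu> < 1/4" "0 < p" "p < 1"
  shows "0 < 2 - beta_plus \<mu> * (1 - p) \<longleftrightarrow> - mu_star p < \<mu>"
proof -
  have "0 < 2 - beta_plus \<mu> * (1 - p) \<longleftrightarrow> beta_plus \<mu> < 2 / (1 - p)"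
    using assms by (simp add: field_simps)
  also have "\<dots> \<longleftrightarrow> 2 / (1 - p) * (1 - 2 / (1 - p)) < \<mu>"
    using assms by (intro beta_plus_less_iff) (auto simp: field_simps)
  also have "2 / (1 - p) * (1 - 2 / (1 - p)) = - mu_star p"
    using assms by (simp add: mu_star_def power2_eq_square divide_simps)
  finally show ?thesis .
qed

text \<open>Here the comparison point is \<open>c = 1 / (1 - p)\<close>. Beyond this threshold an
  error of order \<kappa> is \<open>o(s)\<close>, so the boundary derivative exists.\<close>

lemma kappa_gt_1_iff:
  assumes "\<mu> < 1/4" "0 < p" "p < 1"
  shows "1 < 2 - beta_plus \<mu> * (1 - p) \<longleftrightarrow> - p / (1 - p)^2 < \<mu>"
proof -
  have "1 < 2 - beta_plus \<mu> * (1 - p) \<longleftrightarrow> beta_plus \<mu> < 1 / (1 - p)"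
    using assms by (simp add: field_simps)
  also have "\<dots> \<longleftrightarrow> 1 / (1 - p) * (1 - 1 / (1 - p)) < \<mu>"
    using assms by (intro beta_plus_less_iff) (auto simp: field_simps)
  also have "1 / (1 - p) * (1 - 1 / (1 - p)) = - p / (1 - p)^2"
    using assms by (simp add: power2_eq_square divide_simps)
  finally show ?thesis .
qed

section \<open>Passage from the radius to the distance at either sphere\<close>

text \<open>With \<open>\<sigma> * (r - b)\<close> as the distance, \<open>\<sigma> = -1\<close>
  describes an outer sphere and \<open>\<sigma> = 1\<close> an inner one. The substitution
  \<open>r = b + \<sigma> * s\<close> reduces the claim to \<open>collar_expansion\<close> with
  \<open>m = (N - 1) / 2\<close>.\<close>

lemma expansion_at_boundary_sphere:
  fixes N :: nat and p \<mu> b \<sigma> d :: real and u :: "real \<Rightarrow> real"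
  assumes N: "1 \<le> N" and p: "0 < p" "p < 1" and mu: "- mu_star p < \<mu>" "\<mu> < 1/4"
    and b: "0 < b" and sigma: "\<sigma> = 1 \<or> \<sigma> = -1" and d: "0 < d"
    and pos: "\<And>s. 0 < s \<Longrightarrow> s < d \<Longrightarrow> 0 < u s"
    and sol: "radial_solution_on N p \<mu> (\<lambda>r. \<sigma> * (r - b)) {r. 0 < \<sigma> * (r - b) \<and> \<sigma> * (r - b) < d}
      (\<lambda>r. u (\<sigma> * (r - b)))"
    and lim: "((\<lambda>\<delta>. u \<delta> / \<delta> powr beta_minus \<mu>) \<longlongrightarrow> 0) (at_right 0)"
  shows "\<exists>w0. (w_of \<mu> u \<longlongrightarrow> w0) (at_right 0) \<and>
    (\<lambda>\<delta>. w_of \<mu> u \<delta> - w0) \<in> O[at_right 0](\<lambda>\<delta>. \<delta> powr alpha p \<mu>) \<and>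
    (- p / (1 - p)^2 < \<mu> \<longrightarrow>
      has_boundary_derivative (w_of \<mu> u) w0 (- \<sigma> * (real N - 1) / (2 * b) * w0)) \<and>
    (w0 = 0 \<longrightarrow> w_of \<mu> u \<in> o[at_right 0](\<lambda>\<delta>. \<delta> powr alpha p \<mu>))"
proof -
  have sigma2: "\<sigma> * \<sigma> = 1" "\<bar>\<sigma>\<bar> = 1" using sigma by auto
  have cancel: "\<sigma> * (b + \<sigma> * s - b) = s" for s
    using sigma2 by (simp flip: mult.assoc)
  from sol obtain v' v'' where v:
    "\<And>r. 0 < \<sigma> * (r - b) \<Longrightarrow> \<sigma> * (r - b) < d \<Longrightarrow>
      ((\<lambda>r. u (\<sigma> * (r - b))) has_real_derivative v' r) (at r) \<and>
      (v' has_real_derivative v'' r) (at r) \<and>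
      v'' r + (real N - 1) / r * v' r + \<mu> / (\<sigma> * (r - b))^2 * u (\<sigma> * (r - b)) = u (\<sigma> * (r - b)) powr p"
    unfolding radial_solution_on_def by blast
  have inner: "((\<lambda>s. b + \<sigma> * s) has_real_derivative \<sigma>) (at s)" for s
    by (auto intro!: derivative_eq_intros)
  have u: "(u has_real_derivative \<sigma> * v' (b + \<sigma> * s)) (at s)" if "0 < s" "s < d" for s
    using DERIV_chain2[OF conjunct1[OF v[of "b + \<sigma> * s", unfolded cancel, OF that]] inner]
    unfolding cancel by (simp add: mult.commute)
  \<comment> \<open>Each derivative contributes one factor \<sigma>, so the second derivative of
    \<open>u\<close> is \<open>v''\<close> without a sign.\<close>
  have u': "((\<lambda>s. \<sigma> * v' (b + \<sigma> * s)) has_real_derivative v'' (b + \<sigma> * s)) (at s)"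
    if "0 < s" "s < d" for s
    using DERIV_cmult[OF DERIV_chain2[OF conjunct1[OF conjunct2[OF v[of "b + \<sigma> * s", unfolded cancel, OF that]]] inner],
        of \<sigma>] sigma2 by (simp add: mult.left_commute[of \<sigma>])
  have eq: "v'' (b + \<sigma> * s) + \<sigma> * (2 * ((real N - 1) / 2)) / (b + \<sigma> * s) * (\<sigma> * v' (b + \<sigma> * s)) + \<mu> / s^2 * u s
    = u s powr p" if "0 < s" "s < d" for s
  proof -
    have "\<sigma> * x / y * (\<sigma> * z) = (\<sigma> * \<sigma>) * (x / y * z)" for x y z :: real
      by simp
    moreover have "2 * ((real N - 1) / 2) = real N - 1" by simp
    ultimately show ?thesis
      using v[of "b + \<sigma> * s", unfolded cancel, OF that] by (simp only: sigma2 mult_1_left)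
  qed
  show ?thesis
  proof (rule collar_expansion[OF beta_plus_gt_half[OF mu(2)] beta_plus_mult_one_minus p _ _ b sigma2(2) d
        pos u u' eq, unfolded one_minus_beta_plus, OF _ _ _ _ _ _ _ _ _ _ _ lim])
    show "0 < 2 - beta_plus \<mu> * (1 - p)"
      using kappa_pos_iff[of \<mu> p] mu p by simp
    fix w0
    assume "((\<lambda>s. u s / s powr beta_plus \<mu>) \<longlongrightarrow> w0) (at_right 0)"
      "(\<lambda>s. u s / s powr beta_plus \<mu> - w0) \<in> O[at_right 0](\<lambda>s. s powr min 1 (2 - beta_plus \<mu> * (1 - p)))"
      "1 < 2 - beta_plus \<mu> * (1 - p) \<Longrightarrow>
        has_boundary_derivative (\<lambda>s. u s / s powr beta_plus \<mu>) w0 (- ((real N - 1) / 2 * \<sigma>) / b * w0)"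
      "w0 = 0 \<Longrightarrow> (\<lambda>s. u s / s powr beta_plus \<mu>) \<in> o[at_right 0](\<lambda>s. s powr min 1 (2 - beta_plus \<mu> * (1 - p)))"
    then show ?thesis
      using kappa_gt_1_iff[OF mu(2) p] by (intro exI[of _ w0]) (simp add: w_of_def[abs_def] alpha_def mult_ac)
  qed (use mu N in auto)
qed

theorem proposition2p2:
  fixes N :: nat and p \<mu> R r0 :: real and u :: "real \<Rightarrow> real"
  assumes "1 \<le> N" and "0 < p" and "p < 1"
    and "- mu_star p < \<mu>" and "\<mu> < 1/4" and "\<mu> \<noteq> 0"
    and "positive_solution_near_outer N p \<mu> R u \<or> positive_solution_near_inner N p \<mu> r0 u"
    and "((\<lambda>\<delta>. u \<delta> / \<delta> powr beta_minus \<mu>) \<longlongrightarrow> 0) (at_right 0)"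
  shows "0 < alpha p \<mu> \<and>
    (\<exists>w0::real. (w_of \<mu> u \<longlongrightarrow> w0) (at_right 0) \<and>
      (w0 \<noteq> 0 \<longrightarrow>
        (\<lambda>\<delta>. w_of \<mu> u \<delta> - w0) \<in> O[at_right 0](\<lambda>\<delta>. \<delta> powr alpha p \<mu>)) \<and>
      (- p / (1 - p)^2 < \<mu> \<longrightarrow>
        alpha p \<mu> = 1 \<and>
        (positive_solution_near_outer N p \<mu> R u \<longrightarrow>
          has_boundary_derivative (w_of \<mu> u) w0 ((real N - 1) / (2 * R) * w0)) \<and>
        (positive_solution_near_inner N p \<mu> r0 u \<longrightarrow>
          has_boundary_derivative (w_of \<mu> u) w0 (- (real N - 1) / (2 * r0) * w0))) \<and>
      (w0 = 0 \<longrightarrow>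
        w_of \<mu> u \<in> o[at_right 0](\<lambda>\<delta>. \<delta> powr alpha p \<mu>)))"
proof -
  \<comment> \<open>\<open>D\<close> is the only entry that depends on which sphere is
    considered.\<close>
  let ?P = "\<lambda>D w0. (w_of \<mu> u \<longlongrightarrow> w0) (at_right 0) \<and>
    (\<lambda>\<delta>. w_of \<mu> u \<delta> - w0) \<in> O[at_right 0](\<lambda>\<delta>. \<delta> powr alpha p \<mu>) \<and>
    (- p / (1 - p)^2 < \<mu> \<longrightarrow> has_boundary_derivative (w_of \<mu> u) w0 (D * w0)) \<and>
    (w0 = 0 \<longrightarrow> w_of \<mu> u \<in> o[at_right 0](\<lambda>\<delta>. \<delta> powr alpha p \<mu>))"
  have outer: "\<exists>w0. ?P ((real N - 1) / (2 * R)) w0" if "positive_solution_near_outer N p \<mu> R u"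
  proof -
    from that obtain d where d: "0 < d" "d \<le> R" "\<And>s. 0 < s \<Longrightarrow> s < d \<Longrightarrow> 0 < u s"
      and sol: "radial_solution_on N p \<mu> (\<lambda>r. R - r) {R - d<..<R} (\<lambda>r. u (R - r))"
      by (auto simp: positive_solution_near_outer_def)
    \<comment> \<open>The outer case has \<open>\<sigma> = -1\<close> and \<open>b = R\<close>, so
      the factor \<open>- \<sigma>\<close> makes the derivative coefficient nonnegative.\<close>
    have "{r. 0 < -1 * (r - R) \<and> -1 * (r - R) < d} = {R - d<..<R}" by auto
    with sol have "radial_solution_on N p \<mu> (\<lambda>r. -1 * (r - R)) {r. 0 < -1 * (r - R) \<and> -1 * (r - R) < d}
      (\<lambda>r. u (-1 * (r - R)))" by simp
    from expansion_at_boundary_sphere[OF assms(1-5) _ _ d(1,3) this assms(8)] d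
    show ?thesis by simp
  qed
  have inner: "\<exists>w0. ?P (- (real N - 1) / (2 * r0)) w0" if "positive_solution_near_inner N p \<mu> r0 u"
  proof -
    from that obtain d where d: "0 < r0" "0 < d" "\<And>s. 0 < s \<Longrightarrow> s < d \<Longrightarrow> 0 < u s"
      and sol: "radial_solution_on N p \<mu> (\<lambda>r. r - r0) {r0<..<r0 + d} (\<lambda>r. u (r - r0))"
      by (auto simp: positive_solution_near_inner_def)
    have "{r. 0 < 1 * (r - r0) \<and> 1 * (r - r0) < d} = {r0<..<r0 + d}" by auto
    with sol have "radial_solution_on N p \<mu> (\<lambda>r. 1 * (r - r0)) {r. 0 < 1 * (r - r0) \<and> 1 * (r - r0) < d}
      (\<lambda>r. u (1 * (r - r0)))" by simp
    from expansion_at_boundary_sphere[OF assms(1-5) d(1) _ d(2,3) this assms(8)]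
    show ?thesis by simp
  qed
  \<comment> \<open>The claim asks for one \<open>w0\<close> that serves both the outer and the
    inner implication; uniqueness of limits identifies the values obtained separately.\<close>
  have unique: "w1 = w2" if "(w_of \<mu> u \<longlongrightarrow> w1) (at_right 0)" "(w_of \<mu> u \<longlongrightarrow> w2) (at_right 0)" for w1 w2
    using tendsto_unique[OF _ that] by simp
  obtain w0 where w0: "(w_of \<mu> u \<longlongrightarrow> w0) (at_right 0)"
    using assms(7) outer inner by blast
  have P_outer: "?P ((real N - 1) / (2 * R)) w0" if "positive_solution_near_outer N p \<mu> R u"
    using outer[OF that] unique[OF w0] by metis
  have P_inner: "?P (- (real N - 1) / (2 * r0)) w0" if "positive_solution_near_inner N p \<mu> r0 u"
    using inner[OF that] unique[OF w0] by metis
  have "0 < alpha p \<mu>"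
    using kappa_pos_iff[of \<mu> p] assms by (simp add: alpha_def)
  moreover have "alpha p \<mu> = 1" if "- p / (1 - p)^2 < \<mu>"
    using kappa_gt_1_iff[of \<mu> p] assms that by (simp add: alpha_def)
  ultimately show ?thesis
    using w0 P_outer P_inner assms(7) by blast
qed

end
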